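(* Let $P_n$ be the path graph on $n\geq 5$ vertices. Its diminished Sombor characteristic polynomial satisfies $$\phi(P_n,\lambda)=\lambda^2\,\Omega_{n-2}-\frac{10}{9}\lambda\,\Omega_{n-3}+\frac{25}{81}\,\Omega_{n-4},$$ where $\Omega_1=\lambda$, $\Omega_2=\lambda^2-\frac12$, and $\Omega_k=\lambda\,\Omega_{k-1}-\frac12\,\Omega_{k-2}$ for every $k\geq 3$.
   Context: For a finite simple graph $G$ with vertices $v_1,\dots,v_n$ and degrees $d_i=d_{v_i}$, the diminished Sombor matrix $M_{DS}(G)=(\mu_{ij})$ is the $n\times n$ real symmetric matrix with $\mu_{ij}=\frac{\sqrt{d_i^2+d_j^2}}{d_i+d_j}$ if $v_iv_j\in E(G)$, and $\mu_{ij}=0$ otherwise. The diminished Sombor characteristic polynomial of $G$ is $\phi(G,\lambda)=\det(\lambda I-M_{DS}(G))$. *)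

theory Defs
  imports Complex_Main "Jordan_Normal_Form.Char_Poly"
begin

text \<open>
  A finite simple graph is given by a list \<open>vs\<close> enumerating its vertices
  and a set \<open>E\<close> of two-element sets of vertices.
\<close>

definition simple_graph :: "'a list \<Rightarrow> 'a set set \<Rightarrow> bool" where
  "simple_graph vs E \<longleftrightarrow> distinct vs \<and> (\<forall>e\<in>E. e \<subseteq> set vs \<and> card e = 2)"

definition vertex_degree :: "'a set set \<Rightarrow> 'a \<Rightarrow> nat" where
  "vertex_degree E v = card {e \<in> E. v \<in> e}"

definition dim_sombor_matrix :: "'a list \<Rightarrow> 'a set set \<Rightarrow> real mat" where
  "dim_sombor_matrix vs E = mat (length vs) (length vs) (\<lambda>(i, j).
     if {vs ! i, vs ! j} \<in> E
     then sqrt ((real (vertex_degree E (vs ! i)))\<^sup>2 + (real (vertex_degree E (vs ! j)))\<^sup>2) /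
          (real (vertex_degree E (vs ! i)) + real (vertex_degree E (vs ! j)))
     else 0)"

definition dim_sombor_char_poly :: "'a list \<Rightarrow> 'a set set \<Rightarrow> real poly" where
  "dim_sombor_char_poly vs E = char_poly (dim_sombor_matrix vs E)"

definition path_vertices :: "nat \<Rightarrow> nat list" where
  "path_vertices n = [1..<Suc n]"

definition path_edges :: "nat \<Rightarrow> nat set set" where
  "path_edges n = {{i, Suc i} | i. 1 \<le> i \<and> i < n}"

lemma simple_graph_path: "simple_graph (path_vertices n) (path_edges n)"
  by (auto simp: simple_graph_def path_vertices_def path_edges_def)

lemma poly_dim_sombor_char_poly:
  "poly (dim_sombor_char_poly vs E) x =
     det (x \<cdot>\<^sub>m 1\<^sub>m (length vs) - dim_sombor_matrix vs E)"
proof -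
  let ?M = "dim_sombor_matrix vs E"
  have M: "?M \<in> carrier_mat (length vs) (length vs)"
    by (simp add: dim_sombor_matrix_def)
  have "x \<cdot>\<^sub>m 1\<^sub>m (length vs) - ?M = - (char_matrix ?M x)"
    using M by (intro eq_matI) (auto simp: char_matrix_def)
  then show ?thesis
    by (simp add: dim_sombor_char_poly_def char_poly_matrix[OF M])
qed

end

theory Submission
  imports Defs
begin

text \<open>
  Expanding along the last row, the leading principal minors of a tridiagonal matrix satisfy a
  three-term recurrence involving only the products of opposite off-diagonal entries. For the path
  these products are \<open>5/9\<close> for the two pendant edges and \<open>1/2\<close> for all other edges. The first pendant
  edge turns the minor of order \<open>k\<close> into \<open>\<lambda> \<Omega>\<^sub>k\<^sub>-\<^sub>1 - 5/9 \<Omega>\<^sub>k\<^sub>-\<^sub>2\<close>, and the second one enters in the last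
  step of the recurrence.
\<close>

definition tridiagonal :: "(nat \<Rightarrow> 'a) \<Rightarrow> (nat \<Rightarrow> 'a) \<Rightarrow> (nat \<Rightarrow> 'a) \<Rightarrow> nat \<Rightarrow> 'a::zero mat" where
  "tridiagonal a b c n = mat n n (\<lambda>(i, j).
     if i = j then a i else if j = Suc i then b i else if i = Suc j then c j else 0)"

lemma tridiagonal_carrier: "tridiagonal a b c n \<in> carrier_mat n n"
  by (simp add: tridiagonal_def)

lemma det_tridiagonal_Suc_Suc:
  fixes a b c :: "nat \<Rightarrow> 'a::comm_ring_1"
  shows "det (tridiagonal a b c (Suc (Suc n))) =
    a (Suc n) * det (tridiagonal a b c (Suc n)) - b n * c n * det (tridiagonal a b c n)"
proof -
  let ?T = "tridiagonal a b c"
  let ?D = "mat_delete (?T (Suc (Suc n))) (Suc n) n"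
  have D: "?D \<in> carrier_mat (Suc n) (Suc n)"
    by (simp add: mat_delete_def tridiagonal_def)
  have minor: "mat_delete (?T (Suc m)) m m = ?T m" for m
    by (intro eq_matI) (auto simp: mat_delete_def tridiagonal_def)
  have D_minor: "mat_delete ?D n n = ?T n"
    by (intro eq_matI) (auto simp: mat_delete_def tridiagonal_def)
  \<comment> \<open>The last row of the full matrix has at most two nonzero entries. Deleting it
    with column \<open>n\<close> leaves \<open>b n\<close> as the only possibly nonzero entry of the
    last column, so a second expansion, along that column, reaches order \<open>n\<close>.\<close>
  have D_entry: "?D $$ (i, n) = (if i = n then b n else 0)" if "i < Suc n" for i
    using that by (auto simp: mat_delete_def tridiagonal_def)
  have "det ?D = (\<Sum>i<Suc n. ?D $$ (i, n) * cofactor ?D i n)"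
    by (rule laplace_expansion_column[OF D]) simp
  also have "\<dots> = b n * cofactor ?D n n"
    by (simp add: D_entry)
  finally have det_D: "det ?D = b n * det (?T n)"
    by (simp add: cofactor_def D_minor)
  have "det (?T (Suc (Suc n))) =
      (\<Sum>j<Suc (Suc n). ?T (Suc (Suc n)) $$ (Suc n, j) * cofactor (?T (Suc (Suc n))) (Suc n) j)"
    by (rule laplace_expansion_row[OF tridiagonal_carrier]) simp
  also have "\<dots> = c n * cofactor (?T (Suc (Suc n))) (Suc n) n
      + a (Suc n) * cofactor (?T (Suc (Suc n))) (Suc n) (Suc n)"
    by (simp add: tridiagonal_def)
  finally show ?thesis
    by (simp add: cofactor_def minor det_D algebra_simps)
qed

lemma det_tridiagonal_0: "det (tridiagonal a b c 0) = (1 :: 'a::comm_ring_1)"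
  by (rule det_dim_zero[OF tridiagonal_carrier])

lemma det_tridiagonal_1: "det (tridiagonal a b c (Suc 0)) = (a 0 :: 'a::comm_ring_1)"
  by (subst det_single) (auto simp: tridiagonal_def)

lemma path_edge_iff:
  "{u, v} \<in> path_edges n \<longleftrightarrow>
     1 \<le> u \<and> 1 \<le> v \<and> u \<le> n \<and> v \<le> n \<and> (v = Suc u \<or> u = Suc v)"
  by (auto simp: path_edges_def doubleton_eq_iff)

lemma vertex_degree_path:
  assumes "2 \<le> n" and "1 \<le> v" and "v \<le> n"
  shows "vertex_degree (path_edges n) v = (if v = 1 \<or> v = n then 1 else 2)"
proof -
  have "{e \<in> path_edges n. v \<in> e} =
      (if v = 1 then {{1, 2}} else if v = n then {{n - 1, n}} else {{v - 1, v}, {v, Suc v}})"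
    using assms by (auto simp: path_edges_def numeral_2_eq_2)
  moreover have "{v - 1, v} \<noteq> {v, Suc v}"
    by (auto simp: doubleton_eq_iff)
  ultimately show ?thesis
    by (auto simp: vertex_degree_def)
qed

text \<open>Positions count from 0, so the pendant edges are \<open>i = 0\<close> and
  \<open>i = n - 2\<close>. The values come from the degree pairs (1, 2) and (2, 2); their squares
  are 5/9 and 1/2.\<close>

definition path_weight :: "nat \<Rightarrow> nat \<Rightarrow> real" where
  "path_weight n i = (if i = 0 \<or> Suc (Suc i) = n then sqrt 5 / 3 else sqrt 8 / 4)"

text \<open>From three vertices on, no edge joins two vertices of degree 1; for \<open>n = 2\<close>
  the entry would be \<open>sqrt 2 / 2\<close>.\<close>

lemma dim_sombor_matrix_path:
  assumes "3 \<le> n"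
  shows "dim_sombor_matrix (path_vertices n) (path_edges n) =
    tridiagonal (\<lambda>_. 0) (path_weight n) (path_weight n) n"
proof -
  have nth: "path_vertices n ! i = Suc i" if "i < n" for i
    using that unfolding path_vertices_def by (subst nth_upt) auto
  show ?thesis
    using assms
    by (intro eq_matI)
      (auto simp: dim_sombor_matrix_def tridiagonal_def path_weight_def nth path_edge_iff
        vertex_degree_path path_vertices_def simp del: upt_Suc)
qed

text \<open>The characteristic matrix is again tridiagonal, so the minor recurrence applies over the
  polynomial ring.\<close>

lemma char_poly_tridiagonal:
  "char_poly (tridiagonal a b c n) =
    det (tridiagonal (\<lambda>i. [:- a i, 1:]) (\<lambda>i. [:- b i:]) (\<lambda>i. [:- c i:]) n)"
  unfolding char_poly_def char_poly_matrix_def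
  by (intro arg_cong[where f = det] eq_matI) (auto simp: tridiagonal_def)

theorem theorem3p6:
  fixes n :: nat and \<Omega> :: "nat \<Rightarrow> real poly"
  assumes "n \<ge> 5"
    and "\<Omega> 1 = [:0, 1:]"
    and "\<Omega> 2 = [:0, 1:]\<^sup>2 - [:1/2:]"
    and "\<And>k. k \<ge> 3 \<Longrightarrow> \<Omega> k = [:0, 1:] * \<Omega> (k - 1) - [:1/2:] * (\<Omega> (k - 2))"
  shows "dim_sombor_char_poly (path_vertices n) (path_edges n) =
           [:0, 1:]\<^sup>2 * \<Omega> (n - 2) - [:10/9:] * ([:0, 1:] * \<Omega> (n - 3))
             + [:25/81:] * (\<Omega> (n - 4))"
proof -
  define X :: "real poly" where "X = [:0, 1:]"
  \<comment> \<open>The weights are those of the full path for every \<open>k\<close>, so the second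
    pendant edge first appears at \<open>k = n\<close>.\<close>
  define F where "F k = det (tridiagonal (\<lambda>_. X) (\<lambda>i. [:- path_weight n i:])
    (\<lambda>i. [:- path_weight n i:]) k)" for k
  have \<Omega>_rec: "\<Omega> (Suc (Suc (Suc k))) = X * \<Omega> (Suc (Suc k)) - [:1/2:] * \<Omega> (Suc k)" for k
    using assms(4)[of "Suc (Suc (Suc k))"] by (simp add: X_def)
  have \<Omega>_1: "\<Omega> (Suc 0) = X" and \<Omega>_2: "\<Omega> (Suc (Suc 0)) = X\<^sup>2 - [:1/2:]"
    using assms(2,3) by (simp_all add: X_def numeral_2_eq_2)
  have F_rec: "F (Suc (Suc k)) = X * F (Suc k) -
      [:if k = 0 \<or> Suc (Suc k) = n then 5/9 else 1/2:] * F k" for k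
    unfolding F_def det_tridiagonal_Suc_Suc by (simp add: path_weight_def)
  have F_2: "F (Suc (Suc 0)) = X\<^sup>2 - [:5/9:]"
    unfolding F_rec by (simp add: F_def det_tridiagonal_0 det_tridiagonal_1 power2_eq_square)
  have F_3: "F (Suc (Suc (Suc 0))) = X * \<Omega> (Suc (Suc 0)) - [:5/9:] * \<Omega> (Suc 0)"
    using assms(1) unfolding F_rec[of "Suc 0"] F_2
    by (simp add: F_def det_tridiagonal_1 \<Omega>_1 \<Omega>_2 algebra_simps)
  \<comment> \<open>Two consecutive orders are carried for the second-order recurrence. They start
    at 3 because \<open>\<Omega> 0\<close> is unspecified, and \<open>k + 5 \<le> n\<close> keeps
    them below \<open>n\<close>, before the exceptional last step.\<close>
  have F_\<Omega>: "F (k + 3) = X * \<Omega> (k + 2) - [:5/9:] * \<Omega> (k + 1) \<and>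
      F (k + 4) = X * \<Omega> (k + 3) - [:5/9:] * \<Omega> (k + 2)" if "k + 5 \<le> n" for k
    using that
  proof (induction k)
    case 0
    have "F (Suc (Suc (Suc (Suc 0)))) =
        X * (X * \<Omega> (Suc (Suc 0)) - [:5/9:] * X) - [:1/2:] * (X\<^sup>2 - [:5/9:])"
      using F_rec[of "Suc (Suc 0)"] 0 by (simp add: F_2 F_3 \<Omega>_1)
    \<comment> \<open>Regrouping exchanges the roles of 5/9 and 1/2, exposing
      \<open>\<Omega> 3\<close> and \<open>\<Omega> 2\<close>.\<close>
    also have "\<dots> = X * (X * \<Omega> (Suc (Suc 0)) - [:1/2:] * X) - [:5/9:] * (X\<^sup>2 - [:1/2:])"
      by (simp only: power2_eq_square algebra_simps)
    finally show ?case
      using F_3 \<Omega>_rec[of 0] \<Omega>_1 \<Omega>_2 by (simp add: numeral_eq_Suc)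
  next
    case (Suc k)
    then have IH: "F (k + 3) = X * \<Omega> (k + 2) - [:5/9:] * \<Omega> (k + 1)"
        "F (k + 4) = X * \<Omega> (k + 3) - [:5/9:] * \<Omega> (k + 2)"
      by simp_all
    have \<Omega>: "\<Omega> (k + 3) = X * \<Omega> (k + 2) - [:1/2:] * \<Omega> (k + 1)"
        "\<Omega> (k + 4) = X * \<Omega> (k + 3) - [:1/2:] * \<Omega> (k + 2)"
      using \<Omega>_rec[of k] \<Omega>_rec[of "Suc k"] by (simp_all add: numeral_eq_Suc)
    have "F (k + 5) = X * F (k + 4) - [:1/2:] * F (k + 3)"
      using F_rec[of "k + 3"] Suc.prems by (simp add: numeral_eq_Suc)
    also have "\<dots> = X * \<Omega> (k + 4) - [:5/9:] * \<Omega> (k + 3)"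
      unfolding IH \<Omega> by (simp only: algebra_simps)
    finally show ?case
      using IH(2) by (simp add: numeral_eq_Suc)
  qed
  obtain k where n: "n = k + 5"
    using assms(1) by (metis add.commute le_Suc_ex)
  have "dim_sombor_char_poly (path_vertices n) (path_edges n) = F n"
    using assms(1)
    by (simp add: dim_sombor_char_poly_def dim_sombor_matrix_path char_poly_tridiagonal F_def X_def)
  also have "\<dots> = X * F (k + 4) - [:5/9:] * F (k + 3)"
    using F_rec[of "k + 3"] n by (simp add: numeral_eq_Suc)
  also have "\<dots> = X * (X * \<Omega> (k + 3) - [:5/9:] * \<Omega> (k + 2))
      - [:5/9:] * (X * \<Omega> (k + 2) - [:5/9:] * \<Omega> (k + 1))"
    using F_\<Omega>[of k] n by simp
  also have "\<dots> = X\<^sup>2 * \<Omega> (k + 3) - [:10/9:] * (X * \<Omega> (k + 2)) + [:25/81:] * \<Omega> (k + 1)"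
  proof -
    \<comment> \<open>The rewriting below treats constant polynomials as atoms, so both coefficients
      are first expressed through 5/9.\<close>
    have "[:10/9:] = [:5/9:] + [:5/9 :: real:]" "[:25/81:] = [:5/9:] * [:5/9 :: real:]"
      by simp_all
    then show ?thesis
      by (simp only: power2_eq_square algebra_simps)
  qed
  finally have "dim_sombor_char_poly (path_vertices n) (path_edges n) =
      X\<^sup>2 * \<Omega> (k + 3) - [:10/9:] * (X * \<Omega> (k + 2)) + [:25/81:] * \<Omega> (k + 1)" .
  moreover have "n - 2 = k + 3" "n - 3 = k + 2" "n - 4 = k + 1"
    using n by simp_all
  ultimately show ?thesis
    by (simp only: X_def)
qed

end
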